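(* Let $f\in L^2(\mathbb{R}_+,\mu_r;\mathbb{R}^n)$. The orthogonal projection of $f$ on the subspace $\overline{P_T^0}(\mathbb{R}_+,\mu_r;\mathbb{R}^n)$ of $L^2(\mathbb{R}_+,\mu_r;\mathbb{R}^n)$ is $(\mathcal{E}_T\circ\mathcal{A})f$.
   Context: Fix $n\ge1$ an integer, and real numbers $r>0$, $T>0$. $\mathbb{R}_+=[0,+\infty)$ and $\mu_r$ is the measure on $\mathbb{R}_+$ with density $t\mapsto e^{-rt}$ with respect to Lebesgue measure. $L^2(\mathbb{R}_+,\mu_r;\mathbb{R}^n)$ is the Hilbert space with inner product $(f\mid g)=\int_0^{+\infty}e^{-rt}f(t)\cdot g(t)\,dt$. $P_T^0(\mathbb{R}_+,\mathbb{R}^n)$ is the space of continuous $T$-periodic functions from $\mathbb{R}_+$ to $\mathbb{R}^n$, and $\overline{P_T^0}(\mathbb{R}_+,\mu_r;\mathbb{R}^n)$ is its closure in $L^2(\mathbb{R}_+,\mu_r;\mathbb{R}^n)$. Averaging operator: for $g:\mathbb{R}_+\to\mathbb{R}^n$, $\mathcal{A}g(s):=(1-e^{-rT})\sum_{k=0}^{+\infty}e^{-rkT}g(s+kT)$ for those $s\in[0,T]$ where the series is defined (a.e. $s$ when $g\in L^2(\mathbb{R}_+,\mu_r;\mathbb{R}^n)$). Periodic extension: for $f:[0,T)\to\mathbb{R}^n$, $\mathcal{E}_T(f)(t):=f(t-kT)$ for $t\in[kT,(k+1)T)$, $k\in\mathbb{N}=\{0,1,2,\dots\}$. *)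

theory Defs
  imports "HOL-Analysis.Analysis"
begin

text \<open>Elements of \<open>L\<^sup>2\<close> are represented by functions; two functions represent the same
  element iff they agree almost everywhere.\<close>

definition L2_space :: "'a measure \<Rightarrow> ('a \<Rightarrow> 'b::euclidean_space) set" where
  "L2_space M = {f \<in> borel_measurable M. integrable M (\<lambda>x. (norm (f x))\<^sup>2)}"

definition L2_inner :: "'a measure \<Rightarrow> ('a \<Rightarrow> 'b::euclidean_space) \<Rightarrow> ('a \<Rightarrow> 'b) \<Rightarrow> real" where
  "L2_inner M f g = (\<integral>x. f x \<bullet> g x \<partial>M)"

definition L2_norm :: "'a measure \<Rightarrow> ('a \<Rightarrow> 'b::euclidean_space) \<Rightarrow> real" where
  "L2_norm M f = sqrt (L2_inner M f f)"

definition L2_closure ::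
  "'a measure \<Rightarrow> ('a \<Rightarrow> 'b::euclidean_space) set \<Rightarrow> ('a \<Rightarrow> 'b) set" where
  "L2_closure M S =
     {g \<in> L2_space M. \<forall>\<epsilon>>0. \<exists>p \<in> S \<inter> L2_space M. L2_norm M (\<lambda>x. g x - p x) < \<epsilon>}"

text \<open>\<open>g\<close> represents the orthogonal projection of \<open>f\<close> on the closed subspace \<open>S\<close>.\<close>

definition is_L2_orth_proj ::
  "'a measure \<Rightarrow> ('a \<Rightarrow> 'b::euclidean_space) set \<Rightarrow> ('a \<Rightarrow> 'b) \<Rightarrow> ('a \<Rightarrow> 'b) \<Rightarrow> bool" where
  "is_L2_orth_proj M S f g \<longleftrightarrow> g \<in> S \<and> (\<forall>h\<in>S. L2_inner M (\<lambda>x. f x - g x) h = 0)"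

text \<open>Functions on \<open>[0, \<infinity>)\<close> are total functions on the reals whose values at negative
  arguments are irrelevant: the space of the following measure is \<open>{0..}\<close>.\<close>

definition mu :: "real \<Rightarrow> real measure" where
  "mu r = density (lebesgue_on {0..}) (\<lambda>t. ennreal (exp (- (r * t))))"

definition cont_periodic :: "real \<Rightarrow> (real \<Rightarrow> real ^ 'n) set" where
  "cont_periodic T = {p. continuous_on {0..} p \<and> (\<forall>t\<ge>0. p (t + T) = p t)}"

text \<open>The averaging operator, with the value 0 at points where the series diverges.\<close>

definition averaging :: "real \<Rightarrow> real \<Rightarrow> (real \<Rightarrow> real ^ 'n) \<Rightarrow> real \<Rightarrow> real ^ 'n" where
  "averaging r T g s =
     (if summable (\<lambda>k. exp (- (r * real k * T)) *\<^sub>R g (s + real k * T))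
      then (1 - exp (- (r * T))) *\<^sub>R (\<Sum>k. exp (- (r * real k * T)) *\<^sub>R g (s + real k * T))
      else 0)"

definition periodic_ext :: "real \<Rightarrow> (real \<Rightarrow> real ^ 'n) \<Rightarrow> real \<Rightarrow> real ^ 'n" where
  "periodic_ext T f t = f (t - real (nat \<lfloor>t / T\<rfloor>) * T)"

lemma periodic_ext_eq:
  assumes "T > 0" and "t \<in> {real k * T ..< (real k + 1) * T}"
  shows "periodic_ext T f t = f (t - real k * T)"
proof -
  have "\<lfloor>t / T\<rfloor> = int k"
    using assms by (intro floor_unique) (auto simp: field_simps)
  then show ?thesis
    by (simp add: periodic_ext_def)
qed

end

theory Submission
  imports Defs
begin

text \<open>Cutting \<open>[0, \<infinity>)\<close> into the pieces \<open>[kT, (k+1)T)\<close> gives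
  \<open>\<integral> u d\<mu>\<^sub>r = \<integral>\<^sub>0\<^sup>T e\<^sup>-\<^sup>r\<^sup>s \<Sum>\<^sub>k e\<^sup>-\<^sup>r\<^sup>k\<^sup>T u(s + kT) ds\<close>. Applied to \<open>u = f \<bullet> h\<close> with \<open>h\<close>
  periodic, the inner sum only sees the average \<open>A f\<close>, so \<open>f\<close> and the periodic extension of
  \<open>A f\<close> have the same inner product with \<open>h\<close>; by the Cauchy-Schwarz inequality this passes to
  the closure of the periodic functions. Jensen's inequality \<open>|A f|\<^sup>2 \<le> A(|f|\<^sup>2)\<close> puts the
  extension into \<open>L\<^sup>2\<close>. It lies in the closure because functions in \<open>L\<^sup>2([0, T))\<close> are limits
  of continuous functions vanishing at \<open>0\<close> and \<open>T\<close>, whose periodic extensions are continuous.\<close>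

section \<open>Unfolding integrals over one period\<close>

definition period_piece :: "real \<Rightarrow> nat \<Rightarrow> real set" where
  "period_piece T k = {real k * T ..< (real k + 1) * T}"

lemma period_piece_lebesgue [measurable, simp]: "period_piece T k \<in> sets lebesgue"
  by (simp add: period_piece_def)

text \<open>Existence and uniqueness of the index in one equivalence: it yields both the covering of
  the half-line and the disjointness of the pieces, and its index is the one that
  \<open>periodic_ext\<close> uses.\<close>

lemma mem_period_piece_iff:
  assumes "T > 0" "t \<ge> 0"
  shows "t \<in> period_piece T k \<longleftrightarrow> k = nat \<lfloor>t / T\<rfloor>"
proof -
  have "t \<in> period_piece T k \<longleftrightarrow> real k \<le> t / T \<and> t / T < real k + 1"
    using assms by (simp add: period_piece_def field_simps)
  also have "\<dots> \<longleftrightarrow> \<lfloor>t / T\<rfloor> = int k"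
    by (simp add: floor_eq_iff)
  also have "\<dots> \<longleftrightarrow> k = nat \<lfloor>t / T\<rfloor>"
    using assms by (auto simp: nat_eq_iff)
  finally show ?thesis .
qed

lemma period_piece_nonneg:
  assumes "T > 0" "t \<in> period_piece T k"
  shows "t \<ge> 0"
proof -
  have "0 \<le> real k * T"
    using assms by simp
  also have "\<dots> \<le> t"
    using assms by (simp add: period_piece_def)
  finally show ?thesis .
qed

lemma shift_mem_period_piece_iff: "s + real k * T \<in> period_piece T k \<longleftrightarrow> s \<in> {0..<T}"
  by (auto simp: period_piece_def algebra_simps)

text \<open>A partition of unity written as a series. At most one term is nonzero, so it converges
  without any estimate, also for values in \<open>ennreal\<close>.\<close>

lemma sums_over_period_pieces:
  fixes x :: "'b :: {t2_space, comm_monoid_add}"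
  assumes "T > 0"
  shows "(\<lambda>k. if t \<in> period_piece T k then x else 0) sums (if t \<ge> 0 then x else 0)"
proof (cases "t \<ge> 0")
  case True
  then have "(\<lambda>k. if t \<in> period_piece T k then x else 0) = (\<lambda>k. if k = nat \<lfloor>t / T\<rfloor> then x else 0)"
    using mem_period_piece_iff[OF assms] by auto
  then show ?thesis
    using True sums_single[of "nat \<lfloor>t / T\<rfloor>" "\<lambda>_. x"] by simp
next
  case False
  then have "t \<notin> period_piece T k" for k
    using period_piece_nonneg[OF assms] by blast
  then show ?thesis
    using False by simp
qed

lemma measurable_ident_lebesgue [measurable]: "(\<lambda>t::real. t) \<in> borel_measurable lebesgue"
  by (rule measurable_completion) simp

lemma measurable_ident_lebesgue_on [measurable]: "(\<lambda>t::real. t) \<in> borel_measurable (lebesgue_on S)"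
  by (rule measurable_restrict_space1) measurable

text \<open>Continuity alone is not enough for the completed sigma-algebra: preimages of null sets
  must be null as well, which holds for affine maps.\<close>

lemma measurable_lebesgue_shift [measurable]: "(\<lambda>s::real. s + c) \<in> lebesgue \<rightarrow>\<^sub>M lebesgue"
  using lebesgue_affine_measurable[where c = "\<lambda>_::real. 1" and t = c] by (simp add: add.commute)

text \<open>Monotone convergence swaps sum and integral, and translation invariance moves each piece
  back to \<open>{0..<T}\<close>. No finiteness is assumed, so the lemma can itself serve to prove
  integrability.\<close>

lemma nn_integral_unfold_period:
  fixes F :: "real \<Rightarrow> ennreal"
  assumes T: "T > 0" and F [measurable]: "F \<in> borel_measurable lebesgue"
  shows "(\<integral>\<^sup>+t. F t * indicator {0..} t \<partial>lebesgue)
       = (\<Sum>k. \<integral>\<^sup>+s. F (s + real k * T) * indicator {0..<T} s \<partial>lebesgue)"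
proof -
  have "(\<integral>\<^sup>+t. F t * indicator {0..} t \<partial>lebesgue)
      = (\<integral>\<^sup>+t. (\<Sum>k. if t \<in> period_piece T k then F t else 0) \<partial>lebesgue)"
    by (intro nn_integral_cong)
      (simp add: sums_unique[OF sums_over_period_pieces[OF T], symmetric])
  also have "\<dots> = (\<Sum>k. \<integral>\<^sup>+t. (if t \<in> period_piece T k then F t else 0) \<partial>lebesgue)"
    by (intro nn_integral_suminf) measurable
  also have "\<dots> = (\<Sum>k. \<integral>\<^sup>+s. F (s + real k * T) * indicator {0..<T} s \<partial>lebesgue)"
  proof (intro suminf_cong)
    fix k
    have "(\<integral>\<^sup>+t. (if t \<in> period_piece T k then F t else 0) \<partial>lebesgue)
        = (\<integral>\<^sup>+s. (if s + real k * T \<in> period_piece T k then F (s + real k * T) else 0) \<partial>lebesgue)"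
      by (subst nn_integral_real_affine_lebesgue[where c = 1 and t = "real k * T"])
        (simp_all only: add.commute[of "real k * T"] mult_1 abs_one ennreal_1, measurable)
    also have "\<dots> = (\<integral>\<^sup>+s. F (s + real k * T) * indicator {0..<T} s \<partial>lebesgue)"
      by (intro nn_integral_cong) (simp add: shift_mem_period_piece_iff indicator_def)
    finally show "(\<integral>\<^sup>+t. (if t \<in> period_piece T k then F t else 0) \<partial>lebesgue)
        = (\<integral>\<^sup>+s. F (s + real k * T) * indicator {0..<T} s \<partial>lebesgue)" .
  qed
  finally show ?thesis .
qed

text \<open>The nonnegative version, applied to the norm of \<open>F\<close>, shows that the
  integrals of the norms of the translates have a finite sum. This single bound gives absolute
  convergence almost everywhere and permits integration term by term.\<close>

lemma integral_unfold_period: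
  fixes F :: "real \<Rightarrow> 'b::euclidean_space"
  assumes T: "T > 0" and F: "integrable lebesgue F" and neg: "\<forall>t<0. F t = 0"
  shows "AE s in lebesgue_on {0..<T}. summable (\<lambda>k. norm (F (s + real k * T)))" (is ?ae)
    and "integrable (lebesgue_on {0..<T}) (\<lambda>s. \<Sum>k. F (s + real k * T))" (is ?integrable)
    and "(\<integral>t. F t \<partial>lebesgue) = (\<integral>s. (\<Sum>k. F (s + real k * T)) \<partial>lebesgue_on {0..<T})" (is ?integral)
proof -
  have Fm [measurable]: "F \<in> borel_measurable lebesgue"
    using F by simp
  have 1: "(\<integral>s. F (s + c) \<partial>lebesgue) = (\<integral>t. F t \<partial>lebesgue)"
      "integrable lebesgue (\<lambda>s. F (s + c))"
    if "integrable lebesgue F" for F :: "real \<Rightarrow> 'b" and c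
    using lebesgue_integral_real_affine[of 1 F c] lebesgue_integrable_real_affine[of F 1 c] that
    by (simp_all add: add.commute)
  let ?M = "lebesgue_on {0..<T}"
  have Fk: "integrable ?M (\<lambda>s. F (s + real k * T))" for k
    using 1(2)[OF F] by (simp add: integrable_restrict_space integrable_mult_indicator)
  have Fkm [measurable]: "(\<lambda>s. F (s + real k * T)) \<in> borel_measurable ?M" for k
    using Fk by simp
  have nn: "(\<Sum>k. \<integral>\<^sup>+s. norm (F (s + real k * T)) \<partial>?M) < \<infinity>"
  proof -
    have "(\<Sum>k. \<integral>\<^sup>+s. norm (F (s + real k * T)) \<partial>?M)
        = (\<Sum>k. \<integral>\<^sup>+s. ennreal (norm (F (s + real k * T))) * indicator {0..<T} s \<partial>lebesgue)"
      by (simp add: nn_integral_restrict_space)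
    also have "\<dots> = (\<integral>\<^sup>+t. ennreal (norm (F t)) * indicator {0..} t \<partial>lebesgue)"
      by (intro nn_integral_unfold_period[OF T, symmetric]) measurable
    also have "\<dots> = (\<integral>\<^sup>+t. norm (F t) \<partial>lebesgue)"
      by (intro nn_integral_cong) (auto simp: indicator_def neg)
    also have "\<dots> < \<infinity>"
      using F by (simp add: integrable_iff_bounded)
    finally show ?thesis .
  qed
  have "(\<integral>\<^sup>+s. (\<Sum>k. ennreal (norm (F (s + real k * T)))) \<partial>?M) \<noteq> \<infinity>"
    using nn by (subst nn_integral_suminf) auto
  then have "AE s in ?M. (\<Sum>k. ennreal (norm (F (s + real k * T)))) \<noteq> \<infinity>"
    by (intro nn_integral_PInf_AE) measurable
  then show ae: ?ae
    by eventually_elim (auto intro: summable_suminf_not_top simp: less_top)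
  have sm: "summable (\<lambda>k. \<integral>s. norm (F (s + real k * T)) \<partial>?M)"
  proof (rule summable_suminf_not_top)
    show "(\<Sum>k. ennreal (\<integral>s. norm (F (s + real k * T)) \<partial>?M)) \<noteq> top"
      using nn Fk by (simp add: nn_integral_eq_integral less_top)
  qed simp
  show ?integrable
    by (rule integrable_suminf[OF Fk ae sm])
  have "(\<integral>s. (\<Sum>k. F (s + real k * T)) \<partial>?M) = (\<Sum>k. \<integral>s. F (s + real k * T) \<partial>?M)"
    by (rule integral_suminf[OF Fk ae sm])
  \<comment> \<open>Each translate is moved back to its own piece; countable additivity over the
    disjoint pieces then reassembles the integral over the half-line.\<close>
  also have "\<dots> = (\<Sum>k. LINT t:period_piece T k|lebesgue. F t)"
  proof (intro suminf_cong)
    fix k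
    have "(LINT t:period_piece T k|lebesgue. F t)
        = (\<integral>s. indicator (period_piece T k) (s + real k * T) *\<^sub>R F (s + real k * T) \<partial>lebesgue)"
      unfolding set_lebesgue_integral_def
      by (subst 1(1)[where F = "\<lambda>t. indicator (period_piece T k) t *\<^sub>R F t"])
        (auto intro: integrable_mult_indicator F)
    also have "\<dots> = (\<integral>s. F (s + real k * T) \<partial>?M)"
      by (simp add: integral_restrict_space indicator_def shift_mem_period_piece_iff)
    finally show "(\<integral>s. F (s + real k * T) \<partial>?M) = (LINT t:period_piece T k|lebesgue. F t)"
      by simp
  qed
  also have "\<dots> = (LINT t:(\<Union>k. period_piece T k)|lebesgue. F t)"
  proof (rule lebesgue_integral_countable_add[symmetric])
    show "period_piece T i \<inter> period_piece T j = {}" if "i \<noteq> j" for i j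
    proof (rule ccontr)
      assume "period_piece T i \<inter> period_piece T j \<noteq> {}"
      then obtain t where "t \<in> period_piece T i" "t \<in> period_piece T j"
        by blast
      then show False
        using mem_period_piece_iff[OF T period_piece_nonneg[OF T], of t i] that
          mem_period_piece_iff[OF T period_piece_nonneg[OF T], of t i j] by simp
    qed
    show "set_integrable lebesgue (\<Union>k. period_piece T k) F"
      using F unfolding set_integrable_def by (intro integrable_mult_indicator) auto
  qed simp
  also have "\<dots> = (\<integral>t. F t \<partial>lebesgue)"
    unfolding set_lebesgue_integral_def
  proof (intro Bochner_Integration.integral_cong refl)
    fix t
    show "indicator (\<Union>k. period_piece T k) t *\<^sub>R F t = F t"
      using mem_period_piece_iff[OF T, of t] neg by (cases "t \<ge> 0") (auto simp: indicator_def)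
  qed
  finally show ?integral ..
qed

section \<open>Transfer from Lebesgue measure to the weighted measure \<open>mu r\<close>\<close>

lemma measurable_mu_iff: "f \<in> mu r \<rightarrow>\<^sub>M N \<longleftrightarrow> f \<in> lebesgue_on {0..} \<rightarrow>\<^sub>M N"
  by (simp add: mu_def)

lemma space_mu: "space (mu r) = {0..}"
  by (simp add: mu_def)

lemma measurable_lebesgue_imp_mu:
  assumes "f \<in> lebesgue \<rightarrow>\<^sub>M N"
  shows "f \<in> mu r \<rightarrow>\<^sub>M N"
  unfolding measurable_mu_iff by (rule measurable_restrict_space1[OF assms])

text \<open>The average without its normalising factor. The range is left general because the sum is
  also needed for scalar functions such as \<open>f t \<bullet> h t\<close> and
  \<open>(norm (f t))\<^sup>2\<close>.\<close>

definition geom_sum :: "real \<Rightarrow> real \<Rightarrow> (real \<Rightarrow> 'b::real_normed_vector) \<Rightarrow> real \<Rightarrow> 'b" where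
  "geom_sum r T u s = (\<Sum>k. exp (- (r * real k * T)) *\<^sub>R u (s + real k * T))"

definition abs_geom_summable :: "real \<Rightarrow> real \<Rightarrow> (real \<Rightarrow> 'b::real_normed_vector) \<Rightarrow> real \<Rightarrow> bool" where
  "abs_geom_summable r T u s \<longleftrightarrow>
     summable (\<lambda>k. norm (exp (- (r * real k * T)) *\<^sub>R u (s + real k * T)))"

lemma nn_integral_mu:
  assumes "u \<in> borel_measurable (mu r)"
  shows "(\<integral>\<^sup>+t. u t \<partial>mu r) = (\<integral>\<^sup>+t. ennreal (exp (- (r * t))) * u t * indicator {0..} t \<partial>lebesgue)"
proof -
  have "u \<in> borel_measurable (lebesgue_on {0..})"
    using assms by (simp add: measurable_mu_iff)
  then show ?thesis
    by (simp add: mu_def nn_integral_density nn_integral_restrict_space)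
qed

lemma integrable_mu_iff:
  fixes u :: "real \<Rightarrow> 'b::euclidean_space"
  assumes "u \<in> borel_measurable (mu r)"
  shows "integrable (mu r) u \<longleftrightarrow> integrable lebesgue (\<lambda>t. indicator {0..} t *\<^sub>R exp (- (r * t)) *\<^sub>R u t)"
  using assms unfolding measurable_mu_iff
  by (simp add: mu_def integrable_density integrable_restrict_space)

lemma integral_mu:
  fixes u :: "real \<Rightarrow> 'b::euclidean_space"
  assumes "u \<in> borel_measurable (mu r)"
  shows "(\<integral>t. u t \<partial>mu r) = (\<integral>t. indicator {0..} t *\<^sub>R exp (- (r * t)) *\<^sub>R u t \<partial>lebesgue)"
  using assms unfolding measurable_mu_iff
  by (simp add: mu_def integral_density integral_restrict_space)

lemma integral_mu_unfold:
  fixes u :: "real \<Rightarrow> 'b::euclidean_space"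
  assumes T: "T > 0" and u: "integrable (mu r) u"
  shows "AE s in lebesgue_on {0..<T}. abs_geom_summable r T u s" (is ?ae)
    and "integrable (lebesgue_on {0..<T}) (\<lambda>s. exp (- (r * s)) *\<^sub>R geom_sum r T u s)" (is ?integrable)
    and "(\<integral>t. u t \<partial>mu r) = (\<integral>s. exp (- (r * s)) *\<^sub>R geom_sum r T u s \<partial>lebesgue_on {0..<T})"
      (is ?integral)
proof -
  let ?M = "lebesgue_on {0..<T}"
  define F where "F t = indicator {0..} t *\<^sub>R exp (- (r * t)) *\<^sub>R u t" for t
  have F: "integrable lebesgue F" "(\<integral>t. u t \<partial>mu r) = (\<integral>t. F t \<partial>lebesgue)"
    using u integrable_mu_iff[of u r] integral_mu[of u r] unfolding F_def by simp_all
  have neg: "\<forall>t<0. F t = 0"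
    by (simp add: F_def)
  \<comment> \<open>The weight at \<open>s + real k * T\<close> splits into a factor depending on
    \<open>s\<close> only and the geometric weight depending on \<open>k\<close> only.\<close>
  have Fk: "F (s + real k * T) = exp (- (r * s)) *\<^sub>R exp (- (r * real k * T)) *\<^sub>R u (s + real k * T)"
    if "s \<in> {0..<T}" for s k
    using that T by (simp add: F_def algebra_simps flip: exp_add)
  note unfold = integral_unfold_period[OF T F(1) neg]
  have "AE s in ?M. s \<in> {0..<T}"
    by (rule AE_I2) simp
  with unfold(1) have ae: "AE s in ?M. s \<in> {0..<T} \<and> abs_geom_summable r T u s"
    by eventually_elim (simp add: Fk abs_geom_summable_def mult.assoc summable_cmult_iff)
  then show ?ae
    by eventually_elim simp
  have eq: "(\<Sum>k. F (s + real k * T)) = exp (- (r * s)) *\<^sub>R geom_sum r T u s"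
    if "s \<in> {0..<T}" "abs_geom_summable r T u s" for s
  proof -
    have "summable (\<lambda>k. exp (- (r * real k * T)) *\<^sub>R u (s + real k * T))"
      using that(2) unfolding abs_geom_summable_def by (rule summable_norm_cancel)
    then show ?thesis
      unfolding geom_sum_def Fk[OF that(1)] by (rule suminf_scaleR_right[symmetric])
  qed
  have cong: "AE s in ?M. (\<Sum>k. F (s + real k * T)) = exp (- (r * s)) *\<^sub>R geom_sum r T u s"
    using ae by eventually_elim (simp add: eq)
  \<comment> \<open>The two integrands are known to agree only almost everywhere, so measurability
    of the second is proved directly. Its terms are recovered from \<open>F\<close>, which is
    measurable on the whole line, by undoing the factor \<open>exp (- (r * s))\<close>.\<close>
  have um: "(\<lambda>s. exp (- (r * s)) *\<^sub>R geom_sum r T u s) \<in> borel_measurable ?M"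
  proof -
    have "(\<lambda>s. F (s + real k * T)) \<in> borel_measurable lebesgue" for k
      using borel_measurable_integrable[OF F(1)] by measurable
    then have "(\<lambda>s. exp (r * s) *\<^sub>R F (s + real k * T)) \<in> borel_measurable ?M" for k
      by (intro borel_measurable_scaleR measurable_restrict_space1) auto
    moreover have "exp (r * s) *\<^sub>R F (s + real k * T) = exp (- (r * real k * T)) *\<^sub>R u (s + real k * T)"
      if "s \<in> space ?M" for s k
      using that by (simp add: Fk flip: exp_add)
    ultimately have "(\<lambda>s. exp (- (r * real k * T)) *\<^sub>R u (s + real k * T)) \<in> borel_measurable ?M" for k
      by (rule measurable_cong[THEN iffD1, rotated])
    then have [measurable]: "geom_sum r T u \<in> borel_measurable ?M"
      unfolding geom_sum_def[abs_def] by (rule borel_measurable_suminf)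
    show ?thesis
      by measurable
  qed
  show ?integrable
    using integrable_cong_AE[OF borel_measurable_integrable[OF unfold(2)] um cong] unfold(2) by (rule iffD1)
  show ?integral
    unfolding F(2) unfold(3) by (rule integral_cong_AE[OF borel_measurable_integrable[OF unfold(2)] um cong])
qed

lemma exp_geometric_sums:
  assumes "r > 0" "T > 0"
  shows "(\<lambda>k. exp (- (r * real k * T))) sums (1 / (1 - exp (- (r * T))))"
proof -
  have "(\<lambda>k. exp (- (r * T)) ^ k) sums (1 / (1 - exp (- (r * T))))"
    using assms by (intro geometric_sums) simp
  then show ?thesis
    by (simp add: mult_ac flip: exp_of_nat_mult)
qed

text \<open>By periodicity the pieces contribute a geometric series times one integral over
  \<open>{0..<T}\<close>. Bounding the remaining weight \<open>exp (- (r * s))\<close> by 1 gives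
  the stated estimate, through which convergence over one period becomes convergence for
  \<open>mu r\<close>.\<close>

lemma integrable_mu_periodic:
  fixes v :: "real \<Rightarrow> real"
  assumes r: "r > 0" and T: "T > 0" and vm: "v \<in> borel_measurable (mu r)"
    and per: "\<And>s k. s \<in> {0..<T} \<Longrightarrow> v (s + real k * T) = v s"
    and nonneg: "\<And>t. v t \<ge> 0"
    and int: "integrable (lebesgue_on {0..<T}) v"
  shows "integrable (mu r) v"
    and "(\<integral>t. v t \<partial>mu r) \<le> (\<integral>s. v s \<partial>lebesgue_on {0..<T}) / (1 - exp (- (r * T)))"
proof -
  let ?M = "lebesgue_on {0..<T}" and ?q = "\<lambda>k. exp (- (r * real k * T))"
  \<comment> \<open>Measurability of \<open>v\<close> is given only on the half-line; the extension
    by 0 is measurable on all of \<open>lebesgue\<close>.\<close>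
  define F where "F t = (if t \<in> {0..} then v t else 0)" for t
  have [measurable]: "F \<in> borel_measurable lebesgue"
    using vm unfolding F_def measurable_mu_iff by (intro borel_measurable_if_I) auto
  have F: "F t = v t" if "t \<ge> 0" for t
    using that by (simp add: F_def)
  have q1: "exp (- (r * T)) < 1"
    using r T by simp
  have I: "0 \<le> (\<integral>s. v s \<partial>?M)"
    using nonneg by simp
  have "(\<integral>\<^sup>+t. v t \<partial>mu r) = (\<integral>\<^sup>+t. ennreal (exp (- (r * t))) * ennreal (v t) * indicator {0..} t \<partial>lebesgue)"
    using vm by (intro nn_integral_mu) auto
  also have "\<dots> = (\<integral>\<^sup>+t. ennreal (exp (- (r * t)) * F t) * indicator {0..} t \<partial>lebesgue)"
    using nonneg by (intro nn_integral_cong) (auto simp: indicator_def F ennreal_mult)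
  also have "\<dots> = (\<Sum>k. \<integral>\<^sup>+s. ennreal (exp (- (r * (s + real k * T))) * F (s + real k * T))
                          * indicator {0..<T} s \<partial>lebesgue)"
    by (rule nn_integral_unfold_period[OF T]) measurable
  also have "\<dots> \<le> (\<Sum>k. ennreal (?q k * (\<integral>s. v s \<partial>?M)))"
  proof (intro suminf_le)
    fix k
    have "(\<integral>\<^sup>+s. ennreal (exp (- (r * (s + real k * T))) * F (s + real k * T)) * indicator {0..<T} s \<partial>lebesgue)
        \<le> (\<integral>\<^sup>+s. ennreal (?q k * v s) * indicator {0..<T} s \<partial>lebesgue)"
    proof (intro nn_integral_mono)
      fix s
      show "ennreal (exp (- (r * (s + real k * T))) * F (s + real k * T)) * indicator {0..<T} s
          \<le> ennreal (?q k * v s) * indicator {0..<T} s"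
      proof (cases "s \<in> {0..<T}")
        case True
        then have "F (s + real k * T) = v s"
          using T by (subst F) (auto simp: per)
        moreover have "exp (- (r * (s + real k * T))) \<le> ?q k"
          using True r by (simp add: algebra_simps)
        ultimately show ?thesis
          using nonneg by (simp add: indicator_def mult_right_mono)
      qed simp
    qed
    also have "\<dots> = (\<integral>\<^sup>+s. ennreal (?q k * v s) \<partial>?M)"
      by (subst nn_integral_restrict_space) auto
    also have "\<dots> = ennreal (?q k * (\<integral>s. v s \<partial>?M))"
      using int nonneg by (subst nn_integral_eq_integral) auto
    finally show "(\<integral>\<^sup>+s. ennreal (exp (- (r * (s + real k * T))) * F (s + real k * T)) * indicator {0..<T} s \<partial>lebesgue)
        \<le> ennreal (?q k * (\<integral>s. v s \<partial>?M))" .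
  qed auto
  also have "\<dots> = ennreal ((\<integral>s. v s \<partial>?M) / (1 - exp (- (r * T))))"
    using sums_mult2[OF exp_geometric_sums[OF r T], of "\<integral>s. v s \<partial>?M"] I
    by (intro suminf_ennreal_eq) auto
  finally have le: "(\<integral>\<^sup>+t. v t \<partial>mu r) \<le> ennreal ((\<integral>s. v s \<partial>?M) / (1 - exp (- (r * T))))" .
  show int': "integrable (mu r) v"
    using vm nonneg le by (intro integrableI_nonneg) (auto intro: le_less_trans)
  show "(\<integral>t. v t \<partial>mu r) \<le> (\<integral>s. v s \<partial>?M) / (1 - exp (- (r * T)))"
    using le I q1 nonneg int' by (simp add: nn_integral_eq_integral)
qed

section \<open>Square-integrable functions\<close>

lemma L2_space_diff:
  assumes "f \<in> L2_space M" "g \<in> L2_space M"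
  shows "(\<lambda>x. f x - g x) \<in> L2_space M"
proof -
  have [measurable]: "f \<in> borel_measurable M" "g \<in> borel_measurable M"
    using assms by (auto simp: L2_space_def)
  have "integrable M (\<lambda>x. 2 * (norm (f x))\<^sup>2 + 2 * (norm (g x))\<^sup>2)"
    using assms by (auto simp: L2_space_def)
  then have "integrable M (\<lambda>x. (norm (f x - g x))\<^sup>2)"
  proof (rule Bochner_Integration.integrable_bound)
    have "(norm (f x - g x))\<^sup>2 \<le> 2 * (norm (f x))\<^sup>2 + 2 * (norm (g x))\<^sup>2" for x
    proof -
      \<comment> \<open>The parallelogram law; dropping the second square leaves the bound.\<close>
      have "(norm (f x - g x))\<^sup>2 + (norm (f x + g x))\<^sup>2 = 2 * (norm (f x))\<^sup>2 + 2 * (norm (g x))\<^sup>2"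
        by (simp add: power2_norm_eq_inner inner_commute algebra_simps)
      then show ?thesis
        using zero_le_power2[of "norm (f x + g x)"] by linarith
    qed
    then show "AE x in M. norm ((norm (f x - g x))\<^sup>2) \<le> norm (2 * (norm (f x))\<^sup>2 + 2 * (norm (g x))\<^sup>2)"
      by simp
  qed measurable
  then show ?thesis
    by (simp add: L2_space_def)
qed

lemma integrable_L2_inner:
  assumes "f \<in> L2_space M" "g \<in> L2_space M"
  shows "integrable M (\<lambda>x. f x \<bullet> g x)"
proof -
  have [measurable]: "f \<in> borel_measurable M" "g \<in> borel_measurable M"
    using assms by (auto simp: L2_space_def)
  have "integrable M (\<lambda>x. (norm (f x))\<^sup>2 + (norm (g x))\<^sup>2)"
    using assms by (auto simp: L2_space_def)
  then show ?thesis
  proof (rule Bochner_Integration.integrable_bound)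
    have "\<bar>f x \<bullet> g x\<bar> \<le> (norm (f x))\<^sup>2 + (norm (g x))\<^sup>2" for x
    proof -
      have "\<bar>f x \<bullet> g x\<bar> \<le> norm (f x) * norm (g x)"
        by (rule Cauchy_Schwarz_ineq2)
      then show ?thesis
        using sum_squares_bound[of "norm (f x)" "norm (g x)"] by linarith
    qed
    then show "AE x in M. norm (f x \<bullet> g x) \<le> norm ((norm (f x))\<^sup>2 + (norm (g x))\<^sup>2)"
      by simp
  qed measurable
qed

lemma L2_inner_diff_left:
  assumes "f \<in> L2_space M" "g \<in> L2_space M" "h \<in> L2_space M"
  shows "L2_inner M (\<lambda>x. f x - g x) h = L2_inner M f h - L2_inner M g h"
  using assms by (simp add: L2_inner_def inner_diff_left integrable_L2_inner)

lemma L2_inner_diff_right: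
  assumes "f \<in> L2_space M" "g \<in> L2_space M" "h \<in> L2_space M"
  shows "L2_inner M h (\<lambda>x. f x - g x) = L2_inner M h f - L2_inner M h g"
  using assms by (simp add: L2_inner_def inner_diff_right integrable_L2_inner)

lemma L2_inner_scaleR_right: "L2_inner M f (\<lambda>x. c *\<^sub>R g x) = c * L2_inner M f g"
  by (simp add: L2_inner_def)

lemma L2_inner_commute: "L2_inner M f g = L2_inner M g f"
  by (simp add: L2_inner_def inner_commute)

lemma L2_inner_self_nonneg: "0 \<le> L2_inner M f f"
  by (simp add: L2_inner_def)

lemma L2_inner_self_eq_0_iff:
  assumes "f \<in> L2_space M"
  shows "L2_inner M f f = 0 \<longleftrightarrow> (AE x in M. f x = 0)"
  using integral_nonneg_eq_0_iff_AE[OF integrable_L2_inner[OF assms assms]]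
  by (simp add: L2_inner_def)

lemma L2_space_scaleR:
  assumes "f \<in> L2_space M"
  shows "(\<lambda>x. c *\<^sub>R f x) \<in> L2_space M"
  using assms by (auto simp: L2_space_def power_mult_distrib)

lemma L2_Cauchy_Schwarz:
  assumes f: "f \<in> L2_space M" and g: "g \<in> L2_space M"
  shows "\<bar>L2_inner M f g\<bar> \<le> L2_norm M f * L2_norm M g"
\<comment> \<open>For functions instead of classes the norm is only a seminorm, so this case means
  that \<open>g\<close> vanishes almost everywhere.\<close>
proof (cases "L2_inner M g g = 0")
  case True
  then have "AE x in M. g x = 0"
    using L2_inner_self_eq_0_iff[OF g] by simp
  then have "L2_inner M f g = (\<integral>x. 0 \<partial>M)"
    using f g unfolding L2_inner_def L2_space_def by (intro integral_cong_AE) auto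
  then show ?thesis
    by (simp add: L2_norm_def L2_inner_self_nonneg)
next
  case False
  then have C: "L2_inner M g g > 0"
    using L2_inner_self_nonneg[of M g] by simp
  \<comment> \<open>The coefficient of the projection of \<open>f\<close> on the line spanned by
    \<open>g\<close>, which minimises the norm of \<open>f - t g\<close>.\<close>
  define t where "t = L2_inner M f g / L2_inner M g g"
  note tg = L2_space_scaleR[OF g, of t]
  have "0 \<le> L2_inner M (\<lambda>x. f x - t *\<^sub>R g x) (\<lambda>x. f x - t *\<^sub>R g x)"
    by (rule L2_inner_self_nonneg)
  also have "\<dots> = L2_inner M f f - 2 * t * L2_inner M f g + t\<^sup>2 * L2_inner M g g"
    using L2_inner_commute[of M g f] L2_inner_commute[of M "\<lambda>x. t *\<^sub>R g x"]
    by (simp add: L2_inner_diff_left L2_inner_diff_right L2_space_diff L2_inner_scaleR_right f g tg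
        power2_eq_square algebra_simps)
  also have "\<dots> = L2_inner M f f - (L2_inner M f g)\<^sup>2 / L2_inner M g g"
    using C by (simp add: t_def field_simps power2_eq_square)
  finally have "(L2_inner M f g)\<^sup>2 \<le> L2_inner M f f * L2_inner M g g"
    using C by (simp add: field_simps)
  then have "sqrt ((L2_inner M f g)\<^sup>2) \<le> sqrt (L2_inner M f f * L2_inner M g g)"
    by (rule real_sqrt_le_mono)
  then show ?thesis
    by (simp add: L2_norm_def real_sqrt_mult)
qed

section \<open>The averaging operator\<close>

lemma averaging_eq_geom_sum:
  assumes "abs_geom_summable r T g s"
  shows "averaging r T g s = (1 - exp (- (r * T))) *\<^sub>R geom_sum r T g s"
  using summable_norm_cancel[OF assms[unfolded abs_geom_summable_def]]
  by (simp add: averaging_def geom_sum_def)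

lemma norm_averaging_power2_le:
  fixes f :: "real \<Rightarrow> real ^ 'n"
  assumes r: "r > 0" and T: "T > 0"
    and f: "abs_geom_summable r T f s" and f2: "abs_geom_summable r T (\<lambda>t. (norm (f t))\<^sup>2) s"
  shows "(norm (averaging r T f s))\<^sup>2 \<le> (1 - exp (- (r * T))) * geom_sum r T (\<lambda>t. (norm (f t))\<^sup>2) s"
proof -
  define c m where "c = 1 - exp (- (r * T))" and "m = averaging r T f s"
  define w x where "w k = exp (- (r * real k * T))" and "x k = f (s + real k * T)" for k
  have c: "c > 0"
    using r T by (simp add: c_def)
  \<comment> \<open>Thus the numbers \<open>c * w k\<close> are probability weights on the naturals,
    and \<open>m\<close> is the corresponding mean of the values \<open>x k\<close>.\<close>
  have w: "w sums (1 / c)"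
    using exp_geometric_sums[OF r T] by (simp add: w_def[abs_def] c_def)
  have "(\<lambda>k. w k *\<^sub>R x k) sums geom_sum r T f s"
    unfolding w_def x_def geom_sum_def
    by (rule summable_sums[OF summable_norm_cancel[OF f[unfolded abs_geom_summable_def]]])
  moreover have "geom_sum r T f s = m /\<^sub>R c"
    using c by (simp add: m_def averaging_eq_geom_sum[OF f] flip: c_def)
  ultimately have "(\<lambda>k. w k * (x k \<bullet> m)) sums ((norm m)\<^sup>2 / c)"
    using bounded_linear.sums[OF bounded_linear_inner_left, of "\<lambda>k. w k *\<^sub>R x k" "m /\<^sub>R c" m]
    by (simp add: power2_norm_eq_inner divide_inverse_commute)
  moreover have "(\<lambda>k. w k * (norm (x k))\<^sup>2) sums geom_sum r T (\<lambda>t. (norm (f t))\<^sup>2) s"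
    using summable_sums[OF summable_norm_cancel[OF f2[unfolded abs_geom_summable_def]]]
    by (simp add: w_def x_def geom_sum_def)
  \<comment> \<open>Jensen's inequality by expanding the variance \<open>\<Sum>\<^sub>k w\<^sub>k |x\<^sub>k - m|\<^sup>2 \<ge> 0\<close>\<close>
  ultimately have S: "(\<lambda>k. w k * (norm (x k))\<^sup>2 - 2 * (w k * (x k \<bullet> m)) + w k * (norm m)\<^sup>2)
      sums (geom_sum r T (\<lambda>t. (norm (f t))\<^sup>2) s - 2 * ((norm m)\<^sup>2 / c) + 1 / c * (norm m)\<^sup>2)"
    by (intro sums_add sums_diff sums_mult sums_mult2 w)
  have "0 \<le> w k * (norm (x k))\<^sup>2 - 2 * (w k * (x k \<bullet> m)) + w k * (norm m)\<^sup>2" for k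
  proof -
    have "w k * (norm (x k))\<^sup>2 - 2 * (w k * (x k \<bullet> m)) + w k * (norm m)\<^sup>2 = w k * (norm (x k - m))\<^sup>2"
      by (simp add: power2_norm_eq_inner inner_commute algebra_simps)
    then show ?thesis
      by (simp add: w_def)
  qed
  then have "0 \<le> geom_sum r T (\<lambda>t. (norm (f t))\<^sup>2) s - 2 * ((norm m)\<^sup>2 / c) + 1 / c * (norm m)\<^sup>2"
    by (rule sums_le[OF _ sums_zero S])
  then show ?thesis
    unfolding c_def[symmetric] m_def[symmetric] using c by (simp add: field_simps)
qed

section \<open>Measurability and square integrability of the periodic extension\<close>

lemma measurable_averaging_lebesgue:
  fixes f :: "real \<Rightarrow> real ^ 'n"
  assumes [measurable]: "f \<in> borel_measurable lebesgue"
  shows "averaging r T f \<in> borel_measurable lebesgue"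
proof -
  have [measurable]: "(\<lambda>s. exp (- (r * real k * T)) *\<^sub>R f (s + real k * T)) \<in> borel_measurable lebesgue" for k
    by measurable
  \<comment> \<open>Convergence is replaced by the Cauchy property, which is a countable condition
    and hence measurable. It governs the case distinction with default value 0 in
    \<open>averaging\<close>.\<close>
  have "Measurable.pred lebesgue (\<lambda>s. summable (\<lambda>k. exp (- (r * real k * T)) *\<^sub>R f (s + real k * T)))"
    unfolding summable_iff_convergent Cauchy_convergent_iff[symmetric] by measurable
  then show ?thesis
    unfolding averaging_def[abs_def] by measurable
qed

lemma measurable_periodic_ext:
  assumes [measurable]: "g \<in> borel_measurable lebesgue"
  shows "periodic_ext T g \<in> borel_measurable lebesgue"
proof -
  have "(\<lambda>t. g (t - real k * T)) \<in> borel_measurable lebesgue" for k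
    using measurable_compose[OF measurable_lebesgue_shift[of "- (real k * T)"] assms] by simp
  moreover have "(\<lambda>t. nat \<lfloor>t / T\<rfloor>) \<in> lebesgue \<rightarrow>\<^sub>M count_space UNIV"
    by measurable
  ultimately show ?thesis
    unfolding periodic_ext_def[abs_def] by (rule measurable_compose_countable)
qed

lemma periodic_ext_shift:
  assumes "T > 0" "s \<in> {0..<T}"
  shows "periodic_ext T g (s + real k * T) = g s"
  using assms periodic_ext_eq[of T "s + real k * T" k g] by (simp add: algebra_simps)

lemma period_decomposition:
  fixes t :: real
  assumes "T > 0" "t \<ge> 0"
  obtains s k where "s \<in> {0..<T}" "t = s + real k * T"
proof
  have "t \<in> period_piece T (nat \<lfloor>t / T\<rfloor>)"
    using mem_period_piece_iff assms by blast
  then show "t - real (nat \<lfloor>t / T\<rfloor>) * T \<in> {0..<T}"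
    by (auto simp: period_piece_def algebra_simps)
  show "t = t - real (nat \<lfloor>t / T\<rfloor>) * T + real (nat \<lfloor>t / T\<rfloor>) * T"
    by simp
qed

lemma averaging_cong:
  assumes "T > 0" "s \<ge> 0" "\<And>t. t \<ge> 0 \<Longrightarrow> f t = g t"
  shows "averaging r T f s = averaging r T g s"
  using assms by (simp add: averaging_def)

lemma measurable_periodic_averaging:
  fixes f :: "real \<Rightarrow> real ^ 'n"
  assumes T: "T > 0" and f: "f \<in> borel_measurable (mu r)"
  shows "periodic_ext T (averaging r T f) \<in> borel_measurable (mu r)"
proof -
  \<comment> \<open>Shifts of \<open>f\<close> have to be measurable on the whole line, so
    \<open>f\<close> is extended by 0. At points of the half-line the average only reads values of
    \<open>f\<close> at nonnegative arguments, hence is unchanged.\<close>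
  define f0 where "f0 t = (if t \<in> {0..} then f t else 0)" for t
  have "f0 \<in> borel_measurable lebesgue"
    using f unfolding f0_def measurable_mu_iff by (intro borel_measurable_if_I) auto
  then have "periodic_ext T (averaging r T f0) \<in> borel_measurable (mu r)"
    by (intro measurable_lebesgue_imp_mu measurable_periodic_ext measurable_averaging_lebesgue)
  moreover have "periodic_ext T (averaging r T f0) t = periodic_ext T (averaging r T f) t"
    if "t \<in> space (mu r)" for t
  proof -
    from that have "t \<ge> 0"
      by (simp add: space_mu)
    then obtain s k where "s \<in> {0..<T}" "t = s + real k * T"
      using period_decomposition[OF T] by blast
    then show ?thesis
      using averaging_cong[OF T, of s f0 f] by (simp add: periodic_ext_shift[OF T] f0_def)
  qed
  ultimately show ?thesis
    using measurable_cong by blast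
qed

lemma finite_measure_lebesgue_on_Ico: "finite_measure (lebesgue_on {a..<b::real})"
  by (intro finite_measure_lebesgue_on bounded_set_imp_lmeasurable) auto

lemma integrable_mu_const:
  assumes "r > 0"
  shows "integrable (mu r) (\<lambda>_. c :: real)"
proof -
  interpret finite_measure "lebesgue_on {0..<1::real}"
    by (rule finite_measure_lebesgue_on_Ico)
  have "integrable (mu r) (\<lambda>_. \<bar>c\<bar>)"
    \<comment> \<open>A constant is periodic with every period, here 1; the absolute value provides
      the nonnegativity that the lemma asks for.\<close>
    using assms by (intro integrable_mu_periodic(1)[where T = 1]) auto
  then show ?thesis
    by (rule Bochner_Integration.integrable_bound) auto
qed

text \<open>Constants are integrable for \<open>mu r\<close>, so square integrability implies
  integrability. This makes the series defining the average of \<open>f\<close> converge absolutely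
  almost everywhere.\<close>

lemma L2_space_mu_integrable:
  assumes "r > 0" "f \<in> L2_space (mu r)"
  shows "integrable (mu r) f"
proof (rule Bochner_Integration.integrable_bound)
  show "integrable (mu r) (\<lambda>t. 1 + (norm (f t))\<^sup>2)"
    using assms integrable_mu_const[of r 1] by (auto simp: L2_space_def)
  have "norm (f t) \<le> 1 + (norm (f t))\<^sup>2" for t
    using sum_squares_bound[of 1 "norm (f t)"] norm_ge_zero[of "f t"] unfolding power_one by linarith
  then show "AE t in mu r. norm (f t) \<le> norm (1 + (norm (f t))\<^sup>2)"
    by simp
  show "f \<in> borel_measurable (mu r)"
    using assms by (simp add: L2_space_def)
qed

lemma measurable_mu_imp_period:
  assumes "f \<in> mu r \<rightarrow>\<^sub>M N"
  shows "f \<in> lebesgue_on {0..<T} \<rightarrow>\<^sub>M N"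
  using assms unfolding measurable_mu_iff by (rule measurable_restrict_mono) auto

text \<open>On \<open>{0..<T}\<close> the weight is at least \<open>exp (- (r * T))\<close>, so
  multiplying by \<open>exp (r * T)\<close> compensates for it.\<close>

lemma integrable_mu_imp_period:
  fixes u :: "real \<Rightarrow> 'b::euclidean_space"
  assumes r: "r > 0" and u: "integrable (mu r) u"
  shows "integrable (lebesgue_on {0..<T}) u"
proof (rule Bochner_Integration.integrable_bound)
  let ?F = "\<lambda>t. indicator {0..} t *\<^sub>R exp (- (r * t)) *\<^sub>R u t"
  have "integrable lebesgue ?F"
    using u integrable_mu_iff[of u r] by simp
  then have "integrable (lebesgue_on {0..<T}) ?F"
    using integrable_mult_indicator[of "{0..<T}" lebesgue ?F]
    by (subst integrable_restrict_space) simp_all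
  then show "integrable (lebesgue_on {0..<T}) (\<lambda>t. exp (r * T) *\<^sub>R ?F t)"
    by (rule integrable_scaleR_right)
  show "AE t in lebesgue_on {0..<T}. norm (u t) \<le> norm (exp (r * T) *\<^sub>R ?F t)"
  proof (rule AE_I2)
    fix t
    assume "t \<in> space (lebesgue_on {0..<T})"
    then have t: "0 \<le> t" "t < T"
      by auto
    then have "1 \<le> exp (r * T) * exp (- (r * t))"
      using r by (simp flip: exp_add)
    from mult_right_mono[OF this, of "norm (u t)"] show "norm (u t) \<le> norm (exp (r * T) *\<^sub>R ?F t)"
      using t by (simp add: mult.assoc)
  qed
  show "u \<in> borel_measurable (lebesgue_on {0..<T})"
    by (rule measurable_mu_imp_period[OF borel_measurable_integrable[OF u]])
qed

text \<open>Over one period, Jensen's inequality bounds the squared norm by a constant times the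
  integrand obtained by unfolding the integral of \<open>(norm (f t))\<^sup>2\<close>. Periodicity
  then gives integrability for \<open>mu r\<close>.\<close>

lemma periodic_averaging_L2:
  fixes f :: "real \<Rightarrow> real ^ 'n"
  assumes r: "r > 0" and T: "T > 0" and f: "f \<in> L2_space (mu r)"
  shows "periodic_ext T (averaging r T f) \<in> L2_space (mu r)"
proof -
  let ?M = "lebesgue_on {0..<T}" and ?G = "periodic_ext T (averaging r T f)"
  let ?I = "\<lambda>s. exp (- (r * s)) *\<^sub>R geom_sum r T (\<lambda>t. (norm (f t))\<^sup>2) s"
  have f2: "integrable (mu r) (\<lambda>t. (norm (f t))\<^sup>2)"
    using f by (simp add: L2_space_def)
  have Gm [measurable]: "?G \<in> borel_measurable (mu r)"
    using f by (intro measurable_periodic_averaging[OF T]) (simp add: L2_space_def)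
  note unfold = integral_mu_unfold[OF T f2]
  have "integrable ?M (\<lambda>s. (norm (?G s))\<^sup>2)"
  proof (rule Bochner_Integration.integrable_bound)
    show "integrable ?M (\<lambda>s. exp (r * T) * ?I s)"
      using unfold(2) by simp
    have "AE s in ?M. s \<in> {0..<T}"
      by (rule AE_I2) simp
    with unfold(1) integral_mu_unfold(1)[OF T L2_space_mu_integrable[OF r f]]
    show "AE s in ?M. norm ((norm (?G s))\<^sup>2) \<le> norm (exp (r * T) * ?I s)"
    proof eventually_elim
      case (elim s)
      have "0 \<le> geom_sum r T (\<lambda>t. (norm (f t))\<^sup>2) s"
        using elim(1) unfolding geom_sum_def abs_geom_summable_def
        by (intro suminf_nonneg) simp_all
      \<comment> \<open>A crude comparison through 1: the left side is at most 1, and the right side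
        at least 1 because \<open>s\<close> lies below \<open>T\<close>.\<close>
      moreover have "1 - exp (- (r * T)) \<le> exp (r * T) * exp (- (r * s))"
      proof -
        have "1 - exp (- (r * T)) \<le> 1"
          by simp
        also have "\<dots> \<le> exp (r * (T - s))"
          using elim(3) r by simp
        also have "\<dots> = exp (r * T) * exp (- (r * s))"
          by (simp add: algebra_simps flip: exp_add)
        finally show ?thesis .
      qed
      ultimately have "(1 - exp (- (r * T))) * geom_sum r T (\<lambda>t. (norm (f t))\<^sup>2) s
          \<le> exp (r * T) * exp (- (r * s)) * geom_sum r T (\<lambda>t. (norm (f t))\<^sup>2) s"
        by (rule mult_right_mono[rotated])
      with norm_averaging_power2_le[OF r T elim(2) elim(1)]
      have "(norm (averaging r T f s))\<^sup>2 \<le> exp (r * T) * ?I s"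
        by simp
      moreover have "?G s = averaging r T f s"
        using periodic_ext_shift[OF T elim(3), of "averaging r T f" 0] by simp
      ultimately show ?case
        by simp
    qed
    show "(\<lambda>s. (norm (?G s))\<^sup>2) \<in> borel_measurable ?M"
      using measurable_mu_imp_period[OF Gm, of T] by measurable
  qed
  then have "integrable (mu r) (\<lambda>t. (norm (?G t))\<^sup>2)"
    using T periodic_ext_shift[OF T, of _ "averaging r T f" 0]
    by (intro integrable_mu_periodic(1)[OF r T]) (auto simp: periodic_ext_shift)
  then show ?thesis
    using Gm by (simp add: L2_space_def)
qed

section \<open>Orthogonality to periodic functions and uniqueness of the projection\<close>

lemma periodic_shift:
  fixes h :: "real \<Rightarrow> 'b"
  assumes "T > 0" "\<And>t. t \<ge> 0 \<Longrightarrow> h (t + T) = h t" "s \<ge> 0"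
  shows "h (s + real k * T) = h s"
proof (induction k)
  case (Suc k)
  have "h (s + real k * T + T) = h (s + real k * T)"
    using assms by simp
  then show ?case
    using Suc by (simp add: algebra_simps)
qed simp

text \<open>After unfolding, the periodic \<open>h\<close> leaves the sum over \<open>k\<close>.
  What remains is the geometric sum of \<open>f\<close> on one side and a geometric series times the
  average on the other; the normalising factor makes the two equal.\<close>

lemma L2_inner_periodic_averaging:
  fixes f h :: "real \<Rightarrow> real ^ 'n"
  assumes r: "r > 0" and T: "T > 0" and f: "f \<in> L2_space (mu r)" and h: "h \<in> L2_space (mu r)"
    and per: "\<And>t. t \<ge> 0 \<Longrightarrow> h (t + T) = h t"
  shows "L2_inner (mu r) (periodic_ext T (averaging r T f)) h = L2_inner (mu r) f h"
proof -
  let ?M = "lebesgue_on {0..<T}" and ?G = "periodic_ext T (averaging r T f)"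
  define w where "w k = exp (- (r * real k * T))" for k
  have c: "1 - exp (- (r * T)) > 0"
    using r T by simp
  note hk = periodic_shift[where h = h, OF T per]
  note fh = integral_mu_unfold[OF T integrable_L2_inner[OF f h]]
    and Gh = integral_mu_unfold[OF T integrable_L2_inner[OF periodic_averaging_L2[OF r T f] h]]
  have "AE s in ?M. s \<in> {0..<T}"
    by (rule AE_I2) simp
  with integral_mu_unfold(1)[OF T L2_space_mu_integrable[OF r f]]
  have eq: "AE s in ?M. exp (- (r * s)) *\<^sub>R geom_sum r T (\<lambda>t. ?G t \<bullet> h t) s
      = exp (- (r * s)) *\<^sub>R geom_sum r T (\<lambda>t. f t \<bullet> h t) s"
  proof eventually_elim
    case (elim s)
    have hk: "h (s + real k * T) = h s" for k
      using elim(2) by (intro hk) auto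
    have "(\<lambda>k. w k *\<^sub>R f (s + real k * T)) sums geom_sum r T f s"
      unfolding w_def geom_sum_def
      by (rule summable_sums[OF summable_norm_cancel[OF elim(1)[unfolded abs_geom_summable_def]]])
    from bounded_linear.sums[OF bounded_linear_inner_left this, of "h s"]
    have "geom_sum r T (\<lambda>t. f t \<bullet> h t) s = geom_sum r T f s \<bullet> h s"
      unfolding geom_sum_def w_def[symmetric] by (simp add: hk sums_iff)
    moreover have "geom_sum r T (\<lambda>t. ?G t \<bullet> h t) s = (\<Sum>k. w k * (averaging r T f s \<bullet> h s))"
      using elim(2) by (simp add: geom_sum_def hk periodic_ext_shift[OF T] w_def)
    moreover have "\<dots> = 1 / (1 - exp (- (r * T))) * (averaging r T f s \<bullet> h s)"
      using sums_mult2[OF exp_geometric_sums[OF r T], of "averaging r T f s \<bullet> h s"]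
      by (simp add: sums_iff w_def)
    ultimately show ?case
      using r T c by (simp add: averaging_eq_geom_sum[OF elim(1)])
  qed
  show ?thesis
    unfolding L2_inner_def fh(3) Gh(3)
    by (rule integral_cong_AE[OF borel_measurable_integrable[OF Gh(2)] borel_measurable_integrable[OF fh(2)] eq])
qed

lemma L2_inner_closure_eq_0:
  assumes u: "u \<in> L2_space M" and orth: "\<And>p. p \<in> S \<inter> L2_space M \<Longrightarrow> L2_inner M u p = 0"
    and h: "h \<in> L2_closure M S"
  shows "L2_inner M u h = 0"
proof (rule ccontr)
  assume ne: "L2_inner M u h \<noteq> 0"
  \<comment> \<open>Chosen so that Cauchy-Schwarz forces the inner product to be smaller than
    itself; adding 1 keeps the denominator positive when \<open>u\<close> has norm 0.\<close>
  define e where "e = \<bar>L2_inner M u h\<bar> / (L2_norm M u + 1)"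
  have nn: "0 \<le> L2_norm M u"
    by (simp add: L2_norm_def L2_inner_self_nonneg)
  then have "e > 0"
    using ne by (simp add: e_def)
  then obtain p where p: "p \<in> S \<inter> L2_space M" "L2_norm M (\<lambda>x. h x - p x) < e"
    using h by (auto simp: L2_closure_def)
  have hL: "h \<in> L2_space M"
    using h by (simp add: L2_closure_def)
  have "L2_inner M u h = L2_inner M u (\<lambda>x. h x - p x)"
    using p orth[OF p(1)] by (simp add: L2_inner_diff_right hL u)
  then have "\<bar>L2_inner M u h\<bar> \<le> L2_norm M u * L2_norm M (\<lambda>x. h x - p x)"
    using L2_Cauchy_Schwarz[OF u L2_space_diff[OF hL]] p(1) by simp
  also have "\<dots> \<le> L2_norm M u * e"
    using p(2) nn by (intro mult_left_mono) auto
  also have "\<dots> < (L2_norm M u + 1) * e"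
    using \<open>e > 0\<close> by simp
  also have "\<dots> = \<bar>L2_inner M u h\<bar>"
    using nn by (simp add: e_def)
  finally show False
    by simp
qed

text \<open>Both candidates lie in \<open>S\<close>, so they may be used as test functions
  themselves; the difference is then orthogonal to itself.\<close>

lemma L2_orth_proj_AE_unique:
  assumes S: "S \<subseteq> L2_space M" and f: "f \<in> L2_space M"
    and g: "is_L2_orth_proj M S f g" and g': "is_L2_orth_proj M S f g'"
  shows "AE x in M. g x = g' x"
proof -
  have gL: "g \<in> L2_space M" "g' \<in> L2_space M"
    using S g g' by (auto simp: is_L2_orth_proj_def)
  have "L2_inner M (\<lambda>x. f x - g x) h = 0" "L2_inner M (\<lambda>x. f x - g' x) h = 0" if "h \<in> {g, g'}" for h
    using g g' that by (auto simp: is_L2_orth_proj_def)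
  then have "L2_inner M g h = L2_inner M g' h" if "h \<in> {g, g'}" for h
    using that gL f by (fastforce simp: L2_inner_diff_left)
  then have "L2_inner M (\<lambda>x. g x - g' x) (\<lambda>x. g x - g' x) = 0"
    using gL by (simp add: L2_inner_diff_left L2_inner_diff_right L2_space_diff)
  then show ?thesis
    using L2_inner_self_eq_0_iff[OF L2_space_diff[OF gL]] by simp
qed

section \<open>Approximation by continuous functions\<close>

text \<open>For positive \<open>R\<close> this is the radial retraction onto the closed ball of
  radius \<open>R\<close>; the maximum makes it one continuous formula with a nonzero
  denominator.\<close>

definition radial_trunc :: "real \<Rightarrow> 'b::real_normed_vector \<Rightarrow> 'b" where
  "radial_trunc R v = (R / max R (norm v)) *\<^sub>R v"

lemma radial_trunc_id: "norm v \<le> R \<Longrightarrow> R > 0 \<Longrightarrow> radial_trunc R v = v"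
  by (simp add: radial_trunc_def max_def)

lemma norm_radial_trunc_le: "R > 0 \<Longrightarrow> norm (radial_trunc R v) \<le> R"
  by (cases "v = 0") (auto simp: radial_trunc_def max_def field_simps)

lemma norm_diff_radial_trunc_le:
  assumes "R > 0"
  shows "norm (v - radial_trunc R v) \<le> norm v"
proof -
  have "v - radial_trunc R v = (1 - R / max R (norm v)) *\<^sub>R v"
    by (simp add: radial_trunc_def algebra_simps)
  moreover have "0 \<le> R / max R (norm v)" "R / max R (norm v) \<le> 1"
    using assms by auto
  ultimately show ?thesis
    by (simp add: mult_left_le_one_le)
qed

lemma continuous_on_radial_trunc:
  assumes "R > 0"
  shows "continuous_on S (radial_trunc R)"
proof -
  have "max R (norm v) \<noteq> 0" for v :: 'a
    using assms by (auto simp: max_def)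
  then show ?thesis
    unfolding radial_trunc_def[abs_def] by (intro continuous_intros) auto
qed

text \<open>Dominated convergence along the radii \<open>Suc n\<close>, which are positive for every
  \<open>n\<close>. At each point the difference is eventually 0, and its squared norm never exceeds
  that of \<open>g\<close>.\<close>

lemma radial_trunc_L2_approx:
  fixes g :: "'a \<Rightarrow> 'b::euclidean_space"
  assumes g: "g \<in> L2_space M" and e: "e > 0"
  obtains R where "R > 0" "(\<integral>x. (norm (g x - radial_trunc R (g x)))\<^sup>2 \<partial>M) < e"
proof -
  have [measurable]: "g \<in> borel_measurable M"
    using g by (simp add: L2_space_def)
  have tm [measurable]: "(\<lambda>x. radial_trunc R (g x)) \<in> borel_measurable M" for R
    unfolding radial_trunc_def by measurable
  have "(\<lambda>n. \<integral>x. (norm (g x - radial_trunc (real (Suc n)) (g x)))\<^sup>2 \<partial>M) \<longlonglongrightarrow> (\<integral>x. 0 \<partial>M)"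
  proof (rule integral_dominated_convergence)
    show "integrable M (\<lambda>x. (norm (g x))\<^sup>2)"
      using g by (simp add: L2_space_def)
    show "AE x in M. (\<lambda>n. (norm (g x - radial_trunc (real (Suc n)) (g x)))\<^sup>2) \<longlonglongrightarrow> 0"
    proof (intro AE_I2 tendsto_eventually)
      fix x
      obtain N where N: "norm (g x) \<le> real N"
        using real_arch_simple by blast
      have "(norm (g x - radial_trunc (real (Suc n)) (g x)))\<^sup>2 = 0" if "n \<ge> N" for n
        using N that by (subst radial_trunc_id) auto
      then show "\<forall>\<^sub>F n in sequentially. (norm (g x - radial_trunc (real (Suc n)) (g x)))\<^sup>2 = 0"
        by (auto simp: eventually_sequentially)
    qed
    show "AE x in M. norm ((norm (g x - radial_trunc (real (Suc n)) (g x)))\<^sup>2) \<le> (norm (g x))\<^sup>2" for n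
      using norm_diff_radial_trunc_le[of "real (Suc n)"] by (intro AE_I2) (simp add: power_mono)
  qed measurable
  then have "\<forall>\<^sub>F n in sequentially. (\<integral>x. (norm (g x - radial_trunc (real (Suc n)) (g x)))\<^sup>2 \<partial>M) < e"
    using e by (intro order_tendstoD(2)[where y = 0]) simp_all
  then obtain n where "(\<integral>x. (norm (g x - radial_trunc (real (Suc n)) (g x)))\<^sup>2 \<partial>M) < e"
    by (auto simp: eventually_sequentially)
  then show thesis
    by (intro that[of "real (Suc n)"]) simp
qed

text \<open>A trapezoid for large \<open>n\<close>: it rises with slope \<open>n\<close> from 0 at
  the left end, has height 1 in the middle and falls back to 0 at \<open>T\<close>.\<close>

definition cutoff :: "real \<Rightarrow> nat \<Rightarrow> real \<Rightarrow> real" where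
  "cutoff T n t = max 0 (min 1 (real n * min t (T - t)))"

lemma cutoff_bounds: "0 \<le> cutoff T n t" "cutoff T n t \<le> 1"
  by (auto simp: cutoff_def)

lemma cutoff_eq_0:
  assumes "t \<notin> {0<..<T}"
  shows "cutoff T n t = 0"
proof -
  have "real n * min t (T - t) \<le> 0"
    using assms by (intro mult_nonneg_nonpos) auto
  then show ?thesis
    by (simp add: cutoff_def)
qed

lemma cutoff_tendsto_1:
  assumes "t \<in> {0<..<T}"
  shows "(\<lambda>n. cutoff T n t) \<longlonglongrightarrow> 1"
proof (rule tendsto_eventually)
  have d: "min t (T - t) > 0"
    using assms by auto
  obtain N where N: "1 < real N * min t (T - t)"
    using reals_Archimedean3[OF d] by blast
  have "cutoff T n t = 1" if "n \<ge> N" for n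
  proof -
    have "real N * min t (T - t) \<le> real n * min t (T - t)"
      using that d by (intro mult_right_mono) auto
    then show ?thesis
      using N unfolding cutoff_def by linarith
  qed
  then show "\<forall>\<^sub>F n in sequentially. cutoff T n t = 1"
    by (auto simp: eventually_sequentially)
qed

lemma continuous_on_cutoff: "continuous_on S (cutoff T n)"
  unfolding cutoff_def[abs_def] by (intro continuous_intros)

text \<open>Measurability supplies continuous functions converging to \<open>g\<close> almost
  everywhere. Truncation bounds them by \<open>R\<close> and the cutoff makes them vanish at the
  ends, so dominated convergence on a finite measure gives convergence in mean square to the
  truncation of \<open>g\<close>.\<close>

lemma L2_approx_continuous_vanishing:
  fixes g :: "real \<Rightarrow> 'b::euclidean_space"
  assumes g: "g \<in> L2_space (lebesgue_on {0..<T})" and e: "e > 0"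
  obtains p where "continuous_on UNIV p" "\<And>t. t \<notin> {0<..<T} \<Longrightarrow> p t = 0"
    "integrable (lebesgue_on {0..<T}) (\<lambda>s. (norm (g s - p s))\<^sup>2)"
    "(\<integral>s. (norm (g s - p s))\<^sup>2 \<partial>lebesgue_on {0..<T}) < e"
proof -
  let ?M = "lebesgue_on {0..<T}"
  interpret finite_measure ?M
    by (rule finite_measure_lebesgue_on_Ico)
  have gm [measurable]: "g \<in> borel_measurable ?M"
    using g by (simp add: L2_space_def)
  \<comment> \<open>The final estimate doubles each of two squared errors, hence the share
    \<open>e / 4\<close> for each.\<close>
  obtain R where R: "R > 0" and gR: "(\<integral>s. (norm (g s - radial_trunc R (g s)))\<^sup>2 \<partial>?M) < e / 4"
    using radial_trunc_L2_approx[OF g, of "e / 4"] e by auto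
  have tm: "(\<lambda>s. radial_trunc R (u s)) \<in> borel_measurable ?M"
    if "u \<in> borel_measurable ?M" for u :: "real \<Rightarrow> 'b"
    using that unfolding radial_trunc_def by measurable
  have "(\<lambda>s. if s \<in> {0..<T} then g s else 0) measurable_on UNIV"
    using gm by (intro lebesgue_measurable_imp_measurable_on borel_measurable_if_I) auto
  then obtain N gn where N: "negligible N" and gn: "\<And>n. continuous_on UNIV (gn n)"
    and lim: "\<And>s. s \<notin> N \<Longrightarrow> (\<lambda>n. gn n s) \<longlonglongrightarrow> (if s \<in> {0..<T} then g s else 0)"
    unfolding measurable_on_def by auto
  define p where "p n s = cutoff T n s *\<^sub>R radial_trunc R (gn n s)" for n :: nat and s
  have pc: "continuous_on UNIV (p n)" for n
    unfolding p_def
    by (intro continuous_on_scaleR continuous_on_cutoff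
        continuous_on_compose2[OF continuous_on_radial_trunc[OF R, of UNIV] gn]) auto
  have pm: "p n \<in> borel_measurable ?M" for n
    using pc by (intro measurable_restrict_space1 measurable_completion)
      (simp add: borel_measurable_continuous_onI)
  have pR: "norm (p n s) \<le> R" for n s
  proof -
    have "norm (p n s) \<le> 1 * R"
      unfolding p_def norm_scaleR
      using cutoff_bounds[of T n s] norm_radial_trunc_le[OF R] by (intro mult_mono) auto
    then show ?thesis
      by simp
  qed
  have bound: "(norm (radial_trunc R (g s) - p n s))\<^sup>2 \<le> (2 * R)\<^sup>2" for n s
  proof (rule power_mono)
    show "norm (radial_trunc R (g s) - p n s) \<le> 2 * R"
      using norm_triangle_ineq4[of "radial_trunc R (g s)" "p n s"] pR[of n s]
        norm_radial_trunc_le[OF R, of "g s"] by linarith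
  qed simp
  have "(\<lambda>n. \<integral>s. (norm (radial_trunc R (g s) - p n s))\<^sup>2 \<partial>?M) \<longlonglongrightarrow> (\<integral>s. 0 \<partial>?M)"
  proof (rule integral_dominated_convergence)
    \<comment> \<open>The point 0 is discarded as well because the cutoff is 0 there for every
      \<open>n\<close>; the other end \<open>T\<close> is outside the domain.\<close>
    have "AE s in lebesgue. s \<notin> N \<union> {0}"
      using N by (intro AE_not_in) (auto simp flip: negligible_iff_null_sets)
    then have "AE s in ?M. s \<notin> N \<union> {0}"
      by (subst AE_restrict_space_iff) auto
    moreover have "AE s in ?M. s \<in> {0..<T}"
      by (rule AE_I2) simp
    ultimately show "AE s in ?M. (\<lambda>n. (norm (radial_trunc R (g s) - p n s))\<^sup>2) \<longlonglongrightarrow> 0"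
    proof eventually_elim
      case (elim s)
      have "(\<lambda>n. gn n s) \<longlonglongrightarrow> g s"
        using lim[of s] elim by simp
      then have "(\<lambda>n. radial_trunc R (gn n s)) \<longlonglongrightarrow> radial_trunc R (g s)"
        using continuous_on_tendsto_compose[OF continuous_on_radial_trunc[OF R, of UNIV]] by force
      moreover have "(\<lambda>n. cutoff T n s) \<longlonglongrightarrow> 1"
        using elim by (intro cutoff_tendsto_1) auto
      ultimately have "(\<lambda>n. p n s) \<longlonglongrightarrow> 1 *\<^sub>R radial_trunc R (g s)"
        unfolding p_def by (intro tendsto_scaleR)
      then have "(\<lambda>n. (norm (radial_trunc R (g s) - p n s))\<^sup>2)
          \<longlonglongrightarrow> (norm (radial_trunc R (g s) - 1 *\<^sub>R radial_trunc R (g s)))\<^sup>2"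
        by (intro tendsto_intros)
      then show ?case
        by simp
    qed
    show "AE s in ?M. norm ((norm (radial_trunc R (g s) - p n s))\<^sup>2) \<le> (2 * R)\<^sup>2" for n
      using bound by simp
    show "(\<lambda>s. (norm (radial_trunc R (g s) - p n s))\<^sup>2) \<in> borel_measurable ?M" for n
      using pm[of n] tm[OF gm] by measurable
  qed auto
  then have "\<forall>\<^sub>F n in sequentially. (\<integral>s. (norm (radial_trunc R (g s) - p n s))\<^sup>2 \<partial>?M) < e / 4"
    using e by (intro order_tendstoD(2)[where y = 0]) simp_all
  then obtain n where n: "(\<integral>s. (norm (radial_trunc R (g s) - p n s))\<^sup>2 \<partial>?M) < e / 4"
    by (auto simp: eventually_sequentially)
  have pL: "p n \<in> L2_space ?M"
  proof -
    have "integrable ?M (\<lambda>s. (norm (p n s))\<^sup>2)"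
      using pm[of n] pR[of n] by (intro integrable_const_bound[where B = "R\<^sup>2"]) (auto intro!: AE_I2 power_mono)
    then show ?thesis
      using pm by (simp add: L2_space_def)
  qed
  have tL: "(\<lambda>s. radial_trunc R (g s)) \<in> L2_space ?M"
  proof -
    have "integrable ?M (\<lambda>s. (norm (radial_trunc R (g s)))\<^sup>2)"
      using tm[OF gm] norm_radial_trunc_le[OF R]
      by (intro integrable_const_bound[where B = "R\<^sup>2"]) (auto intro!: AE_I2 power_mono)
    then show ?thesis
      using tm[OF gm] by (simp add: L2_space_def)
  qed
  have int: "integrable ?M (\<lambda>s. (norm (g s - p n s))\<^sup>2)"
      "integrable ?M (\<lambda>s. (norm (g s - radial_trunc R (g s)))\<^sup>2)"
      "integrable ?M (\<lambda>s. (norm (radial_trunc R (g s) - p n s))\<^sup>2)"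
    using L2_space_diff[OF g pL] L2_space_diff[OF g tL] L2_space_diff[OF tL pL]
    by (simp_all add: L2_space_def)
  have "(\<integral>s. (norm (g s - p n s))\<^sup>2 \<partial>?M)
      \<le> (\<integral>s. 2 * (norm (g s - radial_trunc R (g s)))\<^sup>2 + 2 * (norm (radial_trunc R (g s) - p n s))\<^sup>2 \<partial>?M)"
  proof (rule integral_mono)
    fix s
    have "norm (g s - p n s) \<le> norm (g s - radial_trunc R (g s)) + norm (radial_trunc R (g s) - p n s)"
      using norm_triangle_ineq[of "g s - radial_trunc R (g s)" "radial_trunc R (g s) - p n s"] by simp
    then have "(norm (g s - p n s))\<^sup>2
        \<le> (norm (g s - radial_trunc R (g s)) + norm (radial_trunc R (g s) - p n s))\<^sup>2"
      by (rule power_mono) simp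
    also have "\<dots> \<le> 2 * (norm (g s - radial_trunc R (g s)))\<^sup>2 + 2 * (norm (radial_trunc R (g s) - p n s))\<^sup>2"
      using sum_squares_bound[of "norm (g s - radial_trunc R (g s))" "norm (radial_trunc R (g s) - p n s)"]
      by (simp add: power2_sum)
    finally show "(norm (g s - p n s))\<^sup>2
        \<le> 2 * (norm (g s - radial_trunc R (g s)))\<^sup>2 + 2 * (norm (radial_trunc R (g s) - p n s))\<^sup>2" .
  qed (use int in auto)
  also have "\<dots> = 2 * (\<integral>s. (norm (g s - radial_trunc R (g s)))\<^sup>2 \<partial>?M)
      + 2 * (\<integral>s. (norm (radial_trunc R (g s) - p n s))\<^sup>2 \<partial>?M)"
    using int by simp
  also have "\<dots> < e"
    using gR n by simp
  finally have "(\<integral>s. (norm (g s - p n s))\<^sup>2 \<partial>?M) < e" .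
  moreover have "p n t = 0" if "t \<notin> {0<..<T}" for t
    using cutoff_eq_0[OF that] by (simp add: p_def)
  ultimately show thesis
    using that pc int(1) by blast
qed

section \<open>Periodic extensions in the closure\<close>

text \<open>Since \<open>p\<close> vanishes off the open interval, at most one translate is nonzero
  at each point. Writing the extension as a finite sum of translates makes its continuity across the
  multiples of \<open>T\<close> evident.\<close>

lemma periodic_ext_eq_sum:
  assumes T: "T > 0" and vanish: "\<And>t. t \<notin> {0<..<T} \<Longrightarrow> p t = 0"
    and t: "0 \<le> t" "t < real K * T"
  shows "periodic_ext T p t = (\<Sum>k<K. p (t - real k * T))"
proof -
  obtain s j where s: "s \<in> {0..<T}" "t = s + real j * T"
    using period_decomposition[OF T t(1)] by blast
  then have "real j * T \<le> t"
    by simp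
  then have "real j * T < real K * T"
    using t(2) by (rule le_less_trans)
  then have "j < K"
    using T by simp
  have "p (t - real k * T) = 0" if "k \<noteq> j" for k
  proof (rule vanish)
    have "t - real k * T \<in> {0..<T} \<longleftrightarrow> t \<in> period_piece T k"
      by (auto simp: period_piece_def algebra_simps)
    moreover have "t \<in> period_piece T j"
      using s shift_mem_period_piece_iff by blast
    ultimately show "t - real k * T \<notin> {0<..<T}"
      using that mem_period_piece_iff[OF T t(1)] by auto
  qed
  then have "(\<Sum>k<K. p (t - real k * T)) = (\<Sum>k<K. if k = j then p s else 0)"
    using s(2) by (intro sum.cong) auto
  then show ?thesis
    using \<open>j < K\<close> periodic_ext_shift[OF T s(1), of p j] s(2) by simp
qed

lemma periodic_ext_cont_periodic:
  assumes T: "T > 0" and cont: "continuous_on UNIV p" and vanish: "\<And>t. t \<notin> {0<..<T} \<Longrightarrow> p t = 0"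
  shows "periodic_ext T p \<in> cont_periodic T"
proof -
  have "periodic_ext T p (t + T) = periodic_ext T p t" if nonneg: "t \<ge> 0" for t
  proof -
    obtain s k where s: "s \<in> {0..<T}" "t = s + real k * T"
      using period_decomposition[OF T nonneg] by blast
    then have "t + T = s + real (Suc k) * T"
      by (simp add: algebra_simps)
    then show ?thesis
      using s periodic_ext_shift[OF T s(1)] by metis
  qed
  moreover have "continuous_on {0..} (periodic_ext T p)"
    unfolding continuous_on_eq_continuous_within
  proof
    fix t :: real
    assume "t \<in> {0..}"
    obtain K where K: "t < real K * T"
      using reals_Archimedean3[OF T] by blast
    have "continuous_on UNIV (\<lambda>t. \<Sum>k<K. p (t - real k * T))"
      by (intro continuous_intros continuous_on_compose2[OF cont]) auto
    then have "continuous (at t within {0..}) (\<lambda>t. \<Sum>k<K. p (t - real k * T))"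
      using continuous_on_eq_continuous_at continuous_at_imp_continuous_at_within by blast
    then show "continuous (at t within {0..}) (periodic_ext T p)"
    \<comment> \<open>Points closer to \<open>t\<close> than this radius stay below
      \<open>real K * T\<close>, where the finite sum represents the extension.\<close>
    proof (rule continuous_transform_within[where \<delta> = "real K * T - t"])
      show "(\<Sum>k<K. p (x - real k * T)) = periodic_ext T p x"
        if "x \<in> {0..}" "dist x t < real K * T - t" for x
        using that by (intro periodic_ext_eq_sum[OF T vanish, symmetric]) (auto simp: dist_real_def)
    qed (use K \<open>t \<in> {0..}\<close> in auto)
  qed
  ultimately show ?thesis
    by (simp add: cont_periodic_def)
qed

lemma periodic_averaging_in_closure:
  fixes f :: "real \<Rightarrow> real ^ 'n"
  assumes r: "r > 0" and T: "T > 0" and f: "f \<in> L2_space (mu r)"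
  shows "periodic_ext T (averaging r T f) \<in> L2_closure (mu r) (cont_periodic T)"
proof -
  let ?M = "lebesgue_on {0..<T}" and ?G = "periodic_ext T (averaging r T f)"
  let ?c = "1 - exp (- (r * T))"
  have c: "?c > 0"
    using r T by simp
  have GL: "?G \<in> L2_space (mu r)"
    by (rule periodic_averaging_L2[OF r T f])
  have Gm [measurable]: "?G \<in> borel_measurable (mu r)"
    using GL by (simp add: L2_space_def)
  have GM: "?G \<in> L2_space ?M"
    using GL integrable_mu_imp_period[OF r] measurable_mu_imp_period[OF Gm] by (simp add: L2_space_def)
  have "\<exists>P \<in> cont_periodic T \<inter> L2_space (mu r). L2_norm (mu r) (\<lambda>t. ?G t - P t) < e" if "e > 0" for e
  proof -
    \<comment> \<open>The passage from one period to \<open>mu r\<close> costs a factor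
      \<open>1 / ?c\<close>, so this tolerance leaves a squared norm below
      \<open>e\<^sup>2\<close>.\<close>
    have pos: "0 < e\<^sup>2 * ?c"
      using that c by simp
    obtain p where p: "continuous_on UNIV p" and vanish: "\<And>t. t \<notin> {0<..<T} \<Longrightarrow> p t = 0"
      and int: "integrable ?M (\<lambda>s. (norm (?G s - p s))\<^sup>2)"
      and less: "(\<integral>s. (norm (?G s - p s))\<^sup>2 \<partial>?M) < e\<^sup>2 * ?c"
      by (rule L2_approx_continuous_vanishing[OF GM pos]) blast
    define P where "P = periodic_ext T p"
    have P: "P \<in> cont_periodic T"
      unfolding P_def by (rule periodic_ext_cont_periodic[OF T p vanish])
    have Pm [measurable]: "P \<in> borel_measurable (mu r)"
      unfolding P_def using p
      by (intro measurable_lebesgue_imp_mu measurable_periodic_ext measurable_completion)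
        (simp add: borel_measurable_continuous_onI)
    have shift: "?G (s + real k * T) = averaging r T f s" "P (s + real k * T) = p s"
      if "s \<in> {0..<T}" for s k
      using that by (simp_all add: P_def periodic_ext_shift[OF T])
    have GP: "(norm (?G s - P s))\<^sup>2 = (norm (?G s - p s))\<^sup>2" if "s \<in> {0..<T}" for s
      using shift(2)[OF that, of 0] by simp
    have int': "integrable ?M (\<lambda>s. (norm (?G s - P s))\<^sup>2)"
      by (rule Bochner_Integration.integrable_cong[THEN iffD2, OF refl _ int]) (simp add: GP)
    have per: "(norm (?G (s + real k * T) - P (s + real k * T)))\<^sup>2 = (norm (?G s - P s))\<^sup>2"
      if "s \<in> {0..<T}" for s k
      using shift[OF that, of k] shift[OF that, of 0] by simp
    note D = integrable_mu_periodic[OF r T _ per _ int', simplified]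
    have DL: "(\<lambda>t. ?G t - P t) \<in> L2_space (mu r)"
      using D(1) by (simp add: L2_space_def)
    have "(\<integral>t. (norm (?G t - P t))\<^sup>2 \<partial>mu r) \<le> (\<integral>s. (norm (?G s - P s))\<^sup>2 \<partial>?M) / ?c"
      using D(2) by simp
    also have "\<dots> = (\<integral>s. (norm (?G s - p s))\<^sup>2 \<partial>?M) / ?c"
      using Bochner_Integration.integral_cong[OF refl GP, of ?M] by simp
    also have "\<dots> < e\<^sup>2"
      using less c by (simp add: pos_divide_less_eq)
    finally have "L2_inner (mu r) (\<lambda>t. ?G t - P t) (\<lambda>t. ?G t - P t) < e\<^sup>2"
      by (simp add: L2_inner_def power2_norm_eq_inner)
    then have "L2_norm (mu r) (\<lambda>t. ?G t - P t) < e"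
      using that by (simp add: L2_norm_def real_sqrt_less_iff real_less_lsqrt L2_inner_self_nonneg)
    \<comment> \<open>\<open>P\<close> is the difference of the square-integrable functions
      \<open>?G\<close> and \<open>?G - P\<close>.\<close>
    moreover have "P \<in> L2_space (mu r)"
      using L2_space_diff[OF GL DL] by simp
    ultimately show ?thesis
      using P by blast
  qed
  then show ?thesis
    using GL by (simp add: L2_closure_def)
qed

theorem theorem3p2:
  fixes r T :: real and f :: "real \<Rightarrow> real ^ 'n"
  assumes "r > 0" and "T > 0"
    and "f \<in> L2_space (mu r)"
  shows "is_L2_orth_proj (mu r) (L2_closure (mu r) (cont_periodic T)) f
           ((periodic_ext T \<circ> averaging r T) f)
         \<and> (\<forall>g. is_L2_orth_proj (mu r) (L2_closure (mu r) (cont_periodic T)) f g \<longrightarrow>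
              (AE t in mu r. g t = (periodic_ext T \<circ> averaging r T) f t))"
proof -
  let ?S = "L2_closure (mu r) (cont_periodic T)" and ?G = "periodic_ext T (averaging r T f)"
  have GL: "?G \<in> L2_space (mu r)"
    by (rule periodic_averaging_L2[OF assms])
  \<comment> \<open>Orthogonality is checked only against continuous periodic functions;
    \<open>L2_inner_closure_eq_0\<close> extends it to their closure.\<close>
  have "L2_inner (mu r) (\<lambda>t. f t - ?G t) p = 0" if p: "p \<in> cont_periodic T \<inter> L2_space (mu r)" for p
    using p L2_inner_periodic_averaging[OF assms, of p]
    by (simp add: L2_inner_diff_left GL assms cont_periodic_def)
  then have proj: "is_L2_orth_proj (mu r) ?S f ?G"
    using periodic_averaging_in_closure[OF assms]
      L2_inner_closure_eq_0[OF L2_space_diff[OF assms(3) GL]]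
    by (auto simp: is_L2_orth_proj_def)
  moreover have "?S \<subseteq> L2_space (mu r)"
    by (auto simp: L2_closure_def)
  ultimately show ?thesis
    using L2_orth_proj_AE_unique[OF _ assms(3) _ proj] by auto
qed

end
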